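(* Let $(\Omega,\mathcal F,\mathsf P)$ be a probability space, let $p\in(0,1)$, and let $B_1,B_2,\dots$ be an infinite sequence of independent events in $\mathcal F$ such that $\mathsf P(B_i)=p$ for all $i\in\mathbb N=\{1,2,\dots\}$. Let $s$ and $t$ be any two nonnegative integers, and let $$\mathcal P_{\infty,s,t}:=\Big\{(S,T)\colon S\in\tbinom{\mathbb N}s,\ T\in\tbinom{\mathbb N}t,\ S\cap T=\emptyset\Big\}.$$ Let $A\in\mathcal F$ be an event, and suppose that for some $q\in(0,1)$ $$\mathsf P(A\mid B^{S,T})=q\quad\text{for all }(S,T)\in\mathcal P_{\infty,s,t}.$$ Then $A$ is independent of each event of the form $B^{S,T}$ with $(S,T)\in\mathcal P_{\infty,s,t}$; that is, $\mathsf P(A\cap B^{S,T})=\mathsf P(A)\,\mathsf P(B^{S,T})$ for every $(S,T)\in\mathcal P_{\infty,s,t}$.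
   Context: An event is a member of the $\sigma$-algebra $\mathcal F$. Independence of the sequence $(B_i)_{i\in\mathbb N}$ means mutual independence. $\mathsf P(A\mid B)=\mathsf P(A\cap B)/\mathsf P(B)$ for events $A,B$ with $\mathsf P(B)>0$. For any subsets $K,L$ of $\mathbb N$, let $$B^{K,L}:=\Big(\bigcap_{k\in K}B_k\Big)\cap\Big(\bigcap_{l\in L}B_l^{\mathsf c}\Big),$$ where $^{\mathsf c}$ denotes the complement in $\Omega$ and the intersection of an empty family of events is $\Omega$. For a set $E$ and a nonnegative integer $k$, $\binom Ek$ denotes the set of all subsets of $E$ of cardinality $k$. *)

theory Defs
  imports "HOL-Probability.Probability" "HOL-Library.Ramsey"
begin

text \<open>Complements are taken in \<open>space M\<close>; the leading \<open>space M\<close> makes the intersection of the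
  empty family equal to the whole sample space instead of \<open>UNIV\<close>.\<close>

definition pattern_event :: "'a measure \<Rightarrow> (nat \<Rightarrow> 'a set) \<Rightarrow> nat set \<Rightarrow> nat set \<Rightarrow> 'a set" where
  "pattern_event M B K L = space M \<inter> (\<Inter>k\<in>K. B k) \<inter> (\<Inter>l\<in>L. space M - B l)"

text \<open>The index set is the set of positive integers. Members of \<open>nsets\<close> are finite by definition,
  so infinite sets, whose \<open>card\<close> is 0, are not among them.\<close>

definition disjoint_pairs :: "nat \<Rightarrow> nat \<Rightarrow> (nat set \<times> nat set) set" where
  "disjoint_pairs s t = {(S, T). S \<in> nsets {1..} s \<and> T \<in> nsets {1..} t \<and> S \<inter> T = {}}"

end

theory Submission
  imports Defs
begin

text \<open>Independence of \<open>A\<close> from the pattern events amounts to \<open>P(A) = q\<close>, and this follows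
  from a variance estimate. Cut the positive integers into consecutive blocks of length \<open>s + t\<close> and
  prescribe, in block \<open>i\<close>, that the first \<open>s\<close> events occur and the other \<open>t\<close> do not. The resulting
  events \<open>C\<^sub>i\<close> are pairwise independent and all have probability \<open>r = p^s (1-p)^t > 0\<close>, by
  \<open>prob_pattern_event\<close>. Hence \<open>X\<^sub>n = \<Sum>i<n. (1\<^bsub>C\<^sub>i\<^esub> - r)\<close> has second moment at most \<open>n\<close>. On the other
  hand, every \<open>C\<^sub>i\<close> has the same correlation with \<open>A\<close>, so \<open>E(1\<^sub>A X\<^sub>n) = n r (q - P(A))\<close> grows linearly
  in \<open>n\<close> unless \<open>q = P(A)\<close>, whereas by Cauchy--Schwarz its absolute value is at most \<open>\<surd>n\<close>. This
  is \<open>prob_eq_of_constant_correlation\<close>, the place where infinitely many events are essential.\<close>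

lemma pattern_event_Int:
  "pattern_event M B K L \<inter> pattern_event M B K' L' = pattern_event M B (K \<union> K') (L \<union> L')"
  by (auto simp: pattern_event_def)

lemma pattern_event_insert_complement:
  "pattern_event M B K (insert l L) = pattern_event M B K L - pattern_event M B (insert l K) L"
  by (auto simp: pattern_event_def)

context prob_space
begin

lemma indep_eventI:
  assumes "A \<in> events" "B \<in> events" and AB: "prob (A \<inter> B) = prob A * prob B"
  shows "indep_event A B"
  unfolding indep_event_def
proof (rule indep_eventsI)
  show "case_bool A B b \<in> events" for b
    using assms by (cases b) auto
next
  fix J :: "bool set"
  assume "J \<noteq> {}"
  moreover have "J \<in> Pow {True, False}" by (simp flip: UNIV_bool add: insert_commute)
  ultimately consider "J = {True}" | "J = {False}" | "J = {True, False}"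
    by (simp add: Pow_insert) blast
  then show "prob (\<Inter>b\<in>J. case_bool A B b) = (\<Prod>b\<in>J. prob (case_bool A B b))"
    by cases (simp_all add: AB)
qed

lemma sets_pattern_event:
  assumes "countable K" "countable L" "\<And>i. i \<in> K \<union> L \<Longrightarrow> B i \<in> events"
  shows "pattern_event M B K L \<in> events"
proof -
  have "pattern_event M B K L = space M - (\<Union>k\<in>K. space M - B k) - (\<Union>l\<in>L. B l)"
    by (auto simp: pattern_event_def)
  also have "\<dots> \<in> events"
    using assms by (intro sets.Diff sets.top sets.countable_UN'') auto
  finally show ?thesis .
qed

text \<open>Each excluded event is traded for a difference of two pattern events with one exclusion less,
  which reduces the claim to the product rule for intersections of the \<open>B k\<close> and avoids showing
  that independence passes to complements.\<close>

lemma prob_pattern_event: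
  assumes indep: "indep_events B I" and p: "\<And>i. i \<in> I \<Longrightarrow> prob (B i) = p"
    and "finite L" "L \<subseteq> I" "finite K" "K \<subseteq> I" "K \<inter> L = {}"
  shows "prob (pattern_event M B K L) = p ^ card K * (1 - p) ^ card L"
  using assms(3-)
proof (induction L arbitrary: K rule: finite_induct)
  case empty
  have ev: "B i \<in> events" if "i \<in> I" for i
    using indep that by (auto simp: indep_events_def)
  show ?case
  proof (cases "K = {}")
    case True
    then show ?thesis by (simp add: pattern_event_def prob_space)
  next
    case False
    then obtain k where "k \<in> K" by blast
    then have "B k \<subseteq> space M"
      using empty.prems by (intro sets.sets_into_space ev) auto
    with \<open>k \<in> K\<close> have "pattern_event M B K {} = (\<Inter>k\<in>K. B k)"
      by (auto simp: pattern_event_def)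
    moreover have "prob (\<Inter>k\<in>K. B k) = (\<Prod>k\<in>K. prob (B k))"
      using indep False empty.prems by (simp add: indep_events_def)
    moreover have "(\<Prod>k\<in>K. prob (B k)) = p ^ card K"
      using empty.prems p by (subst prod.cong[OF refl, of K _ "\<lambda>_. p"]) auto
    ultimately show ?thesis by simp
  qed
next
  case (insert l L)
  have ev: "B i \<in> events" if "i \<in> I" for i
    using indep that by (auto simp: indep_events_def)
  have l: "l \<notin> K" "l \<in> I" using insert.prems by auto
  have "prob (pattern_event M B K (insert l L))
      = prob (pattern_event M B K L) - prob (pattern_event M B (insert l K) L)"
    unfolding pattern_event_insert_complement
    using insert.prems insert.hyps ev
    by (intro finite_measure_Diff sets_pattern_event) (auto simp: pattern_event_def)
  also have "\<dots> = p ^ card K * (1 - p) ^ card L - p ^ card (insert l K) * (1 - p) ^ card L"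
    using insert.IH[of K] insert.IH[of "insert l K"] insert.prems insert.hyps by auto
  also have "\<dots> = p ^ card K * (1 - p) ^ card (insert l L)"
    using l insert.hyps insert.prems by (simp add: algebra_simps)
  finally show ?case .
qed

text \<open>Off the diagonal the covariances vanish, and each of the \<open>n\<close> diagonal terms is \<open>r - r\<^sup>2 \<le> 1\<close>.\<close>

lemma second_moment_pairwise_indep_le:
  fixes C :: "nat \<Rightarrow> 'a set"
  assumes C: "\<And>i. C i \<in> events" and r: "\<And>i. prob (C i) = r"
    and pair: "\<And>i j. i \<noteq> j \<Longrightarrow> prob (C i \<inter> C j) = r\<^sup>2"
  shows "integrable M (\<lambda>x. (\<Sum>i<n. indicator (C i) x - r)\<^sup>2)"
    and "expectation (\<lambda>x. (\<Sum>i<n. indicator (C i) x - r)\<^sup>2) \<le> n"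
proof -
  have eq: "(\<lambda>x. (indicator (C i) x - r) * (indicator (C j) x - r))
      = (\<lambda>x. indicator (C i \<inter> C j) x - r * indicator (C i) x - r * indicator (C j) x + r\<^sup>2)"
    for i j
    by (auto simp: indicator_def power2_eq_square algebra_simps)
  have int: "integrable M (\<lambda>x. (indicator (C i) x - r) * (indicator (C j) x - r))" for i j
    unfolding eq using C
    by (simp add: less_top[symmetric])
  have cov: "expectation (\<lambda>x. (indicator (C i) x - r) * (indicator (C j) x - r))
      = prob (C i \<inter> C j) - r\<^sup>2" for i j
    unfolding eq using C r by (simp add: prob_space power2_eq_square less_top[symmetric])
  show "integrable M (\<lambda>x. (\<Sum>i<n. indicator (C i) x - r)\<^sup>2)"
    unfolding power2_eq_square sum_product by (intro Bochner_Integration.integrable_sum int)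
  have "expectation (\<lambda>x. (\<Sum>i<n. indicator (C i) x - r)\<^sup>2)
      = expectation (\<lambda>x. \<Sum>i<n. \<Sum>j<n. (indicator (C i) x - r) * (indicator (C j) x - r))"
    by (simp only: power2_eq_square sum_product)
  also have "\<dots> = (\<Sum>i<n. \<Sum>j<n. prob (C i \<inter> C j) - r\<^sup>2)"
    by (simp add: int cov)
  also have "\<dots> \<le> (\<Sum>i<n. \<Sum>j<n. if i = j then 1 else 0)"
    by (intro sum_mono) (use prob_le_1 zero_le_power2[of r] in \<open>smt (verit) pair Int_absorb\<close>)
  also have "\<dots> = n" by simp
  finally show "expectation (\<lambda>x. (\<Sum>i<n. indicator (C i) x - r)\<^sup>2) \<le> n" .
qed

text \<open>The centred partial sums of the \<open>1\<^bsub>C\<^sub>i\<^esub>\<close> have standard deviation of order at most \<open>\<surd>n\<close>, so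
  their covariance with the bounded variable \<open>1\<^sub>A\<close> cannot be \<open>n d\<close> for all \<open>n\<close> with \<open>d \<noteq> 0\<close>.\<close>

lemma prob_eq_of_constant_correlation:
  fixes C :: "nat \<Rightarrow> 'a set"
  assumes C: "\<And>i. C i \<in> events" and r: "\<And>i. prob (C i) = r" and "r > 0"
    and pair: "\<And>i j. i \<noteq> j \<Longrightarrow> prob (C i \<inter> C j) = r\<^sup>2"
    and A: "A \<in> events" and corr: "\<And>i. prob (A \<inter> C i) = q * r"
  shows "prob A = q"
proof -
  define d where "d = r * (q - prob A)"
  define X where "X n x = (\<Sum>i<n. indicator (C i) x - r)" for n x
  have X_int: "integrable M (\<lambda>x. (X n x)\<^sup>2)"
    and X_le: "expectation (\<lambda>x. (X n x)\<^sup>2) \<le> n" for n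
    unfolding X_def using second_moment_pairwise_indep_le[of C r n] C r pair by auto
  have eq: "(\<lambda>x. indicator A x * X n x)
      = (\<lambda>x. \<Sum>i<n. indicator (A \<inter> C i) x - r * indicator A x)" for n
    unfolding X_def sum_distrib_left by (intro ext sum.cong) (auto simp: indicator_def)
  have AX_int: "integrable M (\<lambda>x. indicator A x * X n x)" for n
    unfolding eq using A C 
    by (simp add: less_top[symmetric])
  have AX: "expectation (\<lambda>x. indicator A x * X n x) = n * d" for n
    unfolding eq using A C corr by (simp add: d_def less_top[symmetric] algebra_simps)
  have bound: "n * d\<^sup>2 \<le> 1" for n :: nat
  proof -
    \<comment> \<open>Cauchy--Schwarz, as positivity of a square: among all multipliers \<open>c\<close> of \<open>X n\<close>, the choice
      \<open>c = d\<close> minimises the bound \<open>n c\<^sup>2 - 2 c n d + 1\<close> that the moment estimate gives.\<close>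
    have "0 \<le> expectation (\<lambda>x. (d * X n x - indicator A x)\<^sup>2)"
      by (rule integral_nonneg_AE) simp
    also have "(\<lambda>x. (d * X n x - indicator A x)\<^sup>2)
        = (\<lambda>x. d\<^sup>2 * (X n x)\<^sup>2 - 2 * d * (indicator A x * X n x) + indicator A x)"
      by (auto simp: fun_eq_iff indicator_def power2_eq_square algebra_simps)
    also have "expectation \<dots> = d\<^sup>2 * expectation (\<lambda>x. (X n x)\<^sup>2) - 2 * d * (n * d) + prob A"
      using X_int[of n] AX_int[of n] A by (simp add: AX less_top[symmetric])
    also have "\<dots> \<le> d\<^sup>2 * n - 2 * d * (n * d) + 1"
      by (intro add_mono diff_right_mono mult_left_mono X_le) auto
    finally show ?thesis by (simp add: power2_eq_square algebra_simps)
  qed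
  have "d\<^sup>2 = 0"
  proof (rule ccontr)
    assume "d\<^sup>2 \<noteq> 0"
    then obtain n :: nat where "1 < n * d\<^sup>2"
      using reals_Archimedean3[of "d\<^sup>2"] by auto
    then show False using bound[of n] by simp
  qed
  then show ?thesis using \<open>r > 0\<close> by (simp add: d_def)
qed

end

theorem corollary4:
  fixes M :: "'a measure" and B :: "nat \<Rightarrow> 'a set" and A :: "'a set"
    and p q :: real and s t :: nat
  assumes "prob_space M"
    and "0 < p" and "p < 1"
    and "prob_space.indep_events M B {1..}"
    and "\<And>i. i \<ge> 1 \<Longrightarrow> measure M (B i) = p"
    and "A \<in> sets M"
    and "0 < q" and "q < 1"
    and "\<And>S T. (S, T) \<in> disjoint_pairs s t \<Longrightarrow>
           \<P>(\<omega> in M. \<omega> \<in> A \<bar> \<omega> \<in> pattern_event M B S T) = q"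
  shows "\<forall>(S, T) \<in> disjoint_pairs s t.
           prob_space.indep_event M A (pattern_event M B S T) \<and>
           measure M (A \<inter> pattern_event M B S T)
             = measure M A * measure M (pattern_event M B S T)"
proof -
  interpret prob_space M by fact
  define r where "r = p ^ s * (1 - p) ^ t"
  have "r > 0" using assms(2,3) by (simp add: r_def)
  have B: "B i \<in> events" if "i \<ge> 1" for i
    using assms(4) that by (auto simp: indep_events_def)
  have sets: "pattern_event M B S T \<in> events"
    and prob: "prob (pattern_event M B S T) = r"
    and corr: "prob (A \<inter> pattern_event M B S T) = q * r"
    if "(S, T) \<in> disjoint_pairs s t" for S T
  proof -
    have ST: "S \<subseteq> {1..}" "finite S" "card S = s" "T \<subseteq> {1..}" "finite T" "card T = t" "S \<inter> T = {}"
      using that by (auto simp: disjoint_pairs_def nsets_def)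
    show sets: "pattern_event M B S T \<in> events"
      using ST B by (intro sets_pattern_event) auto
    show prob: "prob (pattern_event M B S T) = r"
      using prob_pattern_event[OF assms(4), of p T S] assms(5) ST by (simp add: r_def)
    have "{\<omega> \<in> space M. \<omega> \<in> A \<and> \<omega> \<in> pattern_event M B S T} = A \<inter> pattern_event M B S T"
      "{\<omega> \<in> space M. \<omega> \<in> pattern_event M B S T} = pattern_event M B S T"
      by (auto simp: pattern_event_def)
    then show "prob (A \<inter> pattern_event M B S T) = q * r"
      using assms(9)[OF that] \<open>r > 0\<close> prob by (simp add: cond_prob_def field_simps)
  qed

  \<comment> \<open>If \<open>s = t = 0\<close> all blocks are empty and every block event is the whole space. Nothing below
    breaks, since then \<open>r = 1\<close>.\<close>
  define S where "S i = {1 + i * (s + t)..<1 + i * (s + t) + s}" for i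
  define T where "T i = {1 + i * (s + t) + s..<1 + Suc i * (s + t)}" for i
  have block: "S i \<union> T i = {1 + i * (s + t)..<1 + Suc i * (s + t)}" for i
    by (auto simp: S_def T_def)
  have blocks_disjoint: "(S i \<union> T i) \<inter> (S j \<union> T j) = {}" if "i \<noteq> j" for i j
  proof -
    have "Suc i * (s + t) \<le> j * (s + t) \<or> Suc j * (s + t) \<le> i * (s + t)"
      using that by (metis Suc_leI linorder_neqE_nat mult_le_mono1)
    then show ?thesis unfolding block by auto
  qed
  have pairs: "(S i, T i) \<in> disjoint_pairs s t" for i
    by (auto simp: disjoint_pairs_def nsets_def S_def T_def)

  have "prob A = q"
  proof (rule prob_eq_of_constant_correlation)
    fix i j :: nat
    assume "i \<noteq> j"
    then have disj: "S i \<inter> S j = {}" "T i \<inter> T j = {}" "(S i \<union> S j) \<inter> (T i \<union> T j) = {}"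
      using blocks_disjoint[of i j] pairs[of i] pairs[of j] by (auto simp: disjoint_pairs_def)
    have card: "card (S i \<union> S j) = s + s" "card (T i \<union> T j) = t + t"
      by (subst card_Un_disjoint; use disj in \<open>simp add: S_def T_def\<close>)+
    show "prob (pattern_event M B (S i) (T i) \<inter> pattern_event M B (S j) (T j)) = r\<^sup>2"
      unfolding pattern_event_Int
      using prob_pattern_event[OF assms(4), of p "T i \<union> T j" "S i \<union> S j"] assms(5) disj pairs
      by (simp add: card r_def disjoint_pairs_def nsets_def power_add power2_eq_square)
  qed (rule sets prob corr pairs \<open>r > 0\<close> assms(6))+
  then have "prob (A \<inter> pattern_event M B S T) = prob A * prob (pattern_event M B S T)"
    if "(S, T) \<in> disjoint_pairs s t" for S T
    using corr[OF that] prob[OF that] by simp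
  then show ?thesis
    using indep_eventI[OF assms(6)] sets by blast
qed

end
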